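(* Let $S \subset \mathbb{N}$. Suppose there exist a positive integer $d$, real numbers $\alpha_1, \dots, \alpha_d$ and a real number $\varepsilon > 0$ such that for every $s \in S$ there exists $1 \le i \le d$ with $\|s\alpha_i\|_{\mathbb{R}/\mathbb{Z}} > \varepsilon$ (i.e. $S$ is not a set of Bohr recurrence). Then $S$ is not $2$-large.
   Context: Here $\mathbb{N}$ is the set of positive integers, and for a real number $x$, $\|x\|_{\mathbb{R}/\mathbb{Z}}$ denotes the distance from $x$ to the nearest integer. A set $S \subset \mathbb{N}$ is called $2$-large if for every coloring of $\mathbb{N}$ with two colors there are arbitrarily long monochromatic arithmetic progressions with common differences in $S$; that is, for every $2$-coloring of $\mathbb{N}$ and every positive integer $k$, there exist $a \in \mathbb{N}$ and $s \in S$ such that $a, a+s, \dots, a+(k-1)s$ all have the same color. A set $S \subset \mathbb{N}$ is a set of Bohr recurrence if for every positive integer $d$, all real numbers $\alpha_1, \dots, \alpha_d$ and every $\varepsilon > 0$, there exists $s \in S$ with $\|s\alpha_i\|_{\mathbb{R}/\mathbb{Z}} < \varepsilon$ for all $1 \le i \le d$. *)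

theory Defs
  imports "HOL-Analysis.Analysis"
begin

definition dist_int :: "real \<Rightarrow> real"
  where "dist_int x = infdist x \<int>"

text \<open>
  The positive integers are modelled inside \<^typ>\<open>nat\<close>. A colouring is a total function on
  \<^typ>\<open>nat\<close>, but only its values at positive integers are relevant: progressions start at
  \<open>a > 0\<close>. The notion is intended for sets \<open>S\<close> of positive integers; if \<open>0 \<in> S\<close> it holds
  trivially, so \<open>S \<subseteq> {0<..}\<close> has to be assumed separately.
\<close>

definition two_large :: "nat set \<Rightarrow> bool"
  where "two_large S \<longleftrightarrow>
    (\<forall>c :: nat \<Rightarrow> bool. \<forall>k>0. \<exists>a>0. \<exists>s\<in>S. \<exists>col. \<forall>j<k. c (a + j * s) = col)"

end

theory Submission
  imports Defs
begin

text \<open>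
  The colour of \<open>n\<close> is the parity of the index of the spherical shell that contains the point of the
  unit cube with coordinates \<open>frac (n * \<alpha>\<^sub>i / m)\<close>, where the squared radius grows by a small
  \<open>h\<close> from one shell to the next. Given a difference \<open>s\<close>, Dirichlet's theorem yields a bounded
  multiple \<open>q * s\<close> that moves this point by a vector \<open>\<phi>\<close> that is short modulo 1. Since \<open>q\<close>
  divides the factorial \<open>m\<close>, the vector \<open>\<phi>\<close> is bounded away from 0, so that boundedly many steps
  travel a fixed distance. Some fixed fraction of these steps crosses no face of the cube. There the
  squared radius is a quadratic function of the step number, and its second difference exceeds
  \<open>2 * h\<close>. As the single steps are too short to skip a shell, both colours occur.
\<close>

text \<open>Over \<open>2 * W\<close> steps one coordinate moves by less than 1, so its floor
  changes at most once and one half of the window avoids the change. Hence each coordinate costs a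
  factor 2 in length, and the induction calls its hypothesis with \<open>2 * W\<close>.\<close>

lemma floor_constant_window:
  fixes x \<phi> :: "'a \<Rightarrow> real" and W :: nat
  assumes "finite I"
    and "\<And>i. i \<in> I \<Longrightarrow> 2 ^ card I * real W * \<bar>\<phi> i\<bar> < 1"
  shows "\<exists>b. b + W \<le> 2 ^ card I * W \<and>
    (\<forall>i\<in>I. \<forall>j\<in>{b..b + W}. \<lfloor>x i + real j * \<phi> i\<rfloor> = \<lfloor>x i + real b * \<phi> i\<rfloor>)"
  using assms
proof (induction I arbitrary: W rule: finite_induct)
  case empty
  then show ?case by simp
next
  case (insert i I)
  have "2 ^ card I * real (2 * W) * \<bar>\<phi> i'\<bar> < 1" if "i' \<in> insert i I" for i'
    using insert.prems[OF that] insert.hyps by (simp add: mult_ac)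
  with insert.IH[of "2 * W"] obtain b where b: "b + 2 * W \<le> 2 ^ card I * (2 * W)"
    and const: "\<forall>i\<in>I. \<forall>j\<in>{b..b + 2 * W}. \<lfloor>x i + real j * \<phi> i\<rfloor> = \<lfloor>x i + real b * \<phi> i\<rfloor>"
    by auto
  define f where "f j = \<lfloor>x i + real j * \<phi> i\<rfloor>" for j
  have pw: "(2::real) ^ card I \<ge> 1" by simp
  have "2 * real W * \<bar>\<phi> i\<bar> \<le> 2 ^ card I * (2 * real W * \<bar>\<phi> i\<bar>)"
    using mult_right_mono[OF pw, of "2 * real W * \<bar>\<phi> i\<bar>"] by simp
  also have "\<dots> < 1"
    using insert.prems[of i] insert.hyps by (simp add: mult_ac)
  finally have short: "2 * real W * \<bar>\<phi> i\<bar> < 1" .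
  \<comment> \<open>The floors are monotone in \<open>j\<close> and change by at most 1 in total, so
    the value at the shared midpoint \<open>b + W\<close> agrees with the value at one of the two
    ends.\<close>
  have halves: "(\<forall>j\<in>{b..b + W}. f j = f b) \<or> (\<forall>j\<in>{b + W..b + W + W}. f j = f (b + W))"
  proof (cases "\<phi> i \<ge> 0")
    case True
    have mono: "f j \<le> f j'" if "j \<le> j'" for j j'
      unfolding f_def using that True by (intro floor_mono add_left_mono mult_right_mono) auto
    have "f (b + W + W) \<le> f b + 1"
      using short True unfolding f_def by (simp add: algebra_simps) linarith
    then show ?thesis
      using mono[of b "b + W"] mono[of "b + W" "b + W + W"] mono
      by (smt (verit, best) atLeastAtMost_iff)
  next
    case False
    have mono: "f j' \<le> f j" if "j \<le> j'" for j j'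
      unfolding f_def using that False by (intro floor_mono add_left_mono mult_right_mono_neg) auto
    have "f b \<le> f (b + W + W) + 1"
      using short False unfolding f_def by (simp add: algebra_simps) linarith
    then show ?thesis
      using mono[of b "b + W"] mono[of "b + W" "b + W + W"] mono
      by (smt (verit, best) atLeastAtMost_iff)
  qed
  have sub: "\<lfloor>x i' + real j * \<phi> i'\<rfloor> = \<lfloor>x i' + real b' * \<phi> i'\<rfloor>"
    if "i' \<in> I" "b \<le> b'" "b' \<le> b + W" "j \<in> {b'..b' + W}" for i' b' j
  proof -
    have "j \<in> {b..b + 2 * W}" "b' \<in> {b..b + 2 * W}" using that by auto
    with const that(1) show ?thesis by metis
  qed
  have window: ?case if b': "b \<le> b'" "b' \<le> b + W" "\<forall>j\<in>{b'..b' + W}. f j = f b'" for b'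
  proof (intro exI conjI ballI)
    have "2 ^ card (insert i I) * W = 2 ^ card I * (2 * W)"
      using insert.hyps by simp
    then show "b' + W \<le> 2 ^ card (insert i I) * W"
      using b b'(2) by linarith
    show "\<lfloor>x i' + real j * \<phi> i'\<rfloor> = \<lfloor>x i' + real b' * \<phi> i'\<rfloor>"
      if "i' \<in> insert i I" "j \<in> {b'..b' + W}" for i' j
      using that sub[OF _ b'(1,2)] b'(3) unfolding f_def by blast
  qed
  show ?case
    using halves window[OF order.refl le_add1] window[OF le_add1 order.refl] by blast
qed

text \<open>A step shorter than 1 changes the floor by at most 1, and a change by exactly 1 would
  flip the parity. So a monochromatic run cannot leave its shell.\<close>

lemma same_parity_imp_floor_constant:
  fixes g :: "nat \<Rightarrow> real"
  assumes "\<And>j. b \<le> j \<Longrightarrow> j \<le> c \<Longrightarrow> even \<lfloor>g j\<rfloor> = col"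
    and "\<And>j. b \<le> j \<Longrightarrow> j < c \<Longrightarrow> \<bar>g (Suc j) - g j\<bar> < 1"
    and "b \<le> j" "j \<le> c"
  shows "\<lfloor>g j\<rfloor> = \<lfloor>g b\<rfloor>"
  using assms(3,4)
proof (induction j rule: dec_induct)
  case base
  then show ?case by simp
next
  case (step j)
  have "even \<lfloor>g (Suc j)\<rfloor> = even \<lfloor>g j\<rfloor>"
    using assms(1)[of j] assms(1)[of "Suc j"] step by auto
  moreover have "\<bar>\<lfloor>g (Suc j)\<rfloor> - \<lfloor>g j\<rfloor>\<bar> \<le> 1"
    using assms(2)[of j] step by linarith
  ultimately have "\<lfloor>g (Suc j)\<rfloor> = \<lfloor>g j\<rfloor>" by presburger
  then show ?case using step by simp
qed

text \<open>Squared distance from the corner 0 to the representative of \<open>x\<close> modulo 1 in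
  the half-open unit cube. Using the square makes it a quadratic polynomial along a progression that
  crosses no face.\<close>

definition radius_sq :: "'a set \<Rightarrow> ('a \<Rightarrow> real) \<Rightarrow> real"
  where "radius_sq I x = (\<Sum>i\<in>I. (frac (x i))\<^sup>2)"

text \<open>If all these colours agreed, the squared radius would stay in one shell of width
  \<open>h\<close> throughout a window without crossings, which bounds its second difference
  strictly below \<open>2 * h\<close>; convexity makes it at least \<open>2 * h\<close>. Total
  travel 1 leaves room to find such a window.\<close>

lemma shells_not_monochromatic:
  fixes x \<phi> :: "'a \<Rightarrow> real" and \<mu> h :: real
  assumes fin: "finite I"
    and h: "h = (1 / 2 ^ (card I + 3))\<^sup>2"
    and \<mu>: "\<mu> > 0" "2 * real (card I) * \<mu> < h"
    and le: "\<And>i. i \<in> I \<Longrightarrow> \<bar>\<phi> i\<bar> \<le> \<mu>"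
    and k: "k \<in> I" "\<bar>\<phi> k\<bar> = \<mu>"
  shows "\<exists>j. real j * \<mu> \<le> 1 \<and> even \<lfloor>radius_sq I (\<lambda>i. x i + real j * \<phi> i) / h\<rfloor> \<noteq> col"
proof (rule ccontr)
  define g where "g j = radius_sq I (\<lambda>i. x i + real j * \<phi> i)" for j
  assume "\<not> ?thesis"
  then have mono: "even \<lfloor>g j / h\<rfloor> = col" if "real j * \<mu> \<le> 1" for j
    using that unfolding g_def by blast
  define r :: real where "r = 1 / 2 ^ (card I + 3)"
  have r: "r > 0" "r \<le> 1" "h = r\<^sup>2" unfolding r_def h by (auto simp: divide_le_eq)
  then have h0: "h > 0" by simp
  \<comment> \<open>The stride satisfies r < W * \<mu> \<le> 2 * r: the lower bound makes the second
    difference large, the upper one limits the travel.\<close>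
  define W where "W = nat \<lfloor>2 * r / \<mu>\<rfloor>"
  have card1: "card I \<ge> 1" using k fin by (metis One_nat_def Suc_leI card_gt_0_iff empty_iff)
  have "\<mu> \<le> 2 * real (card I) * \<mu>" using card1 \<mu>(1) by simp
  also have "\<dots> < r" using \<mu>(2) r by (smt (verit) mult_left_le power2_eq_square)
  finally have "\<mu> < r" .
  have W: "real W = of_int \<lfloor>2 * r / \<mu>\<rfloor>"
    unfolding W_def using \<mu>(1) r by simp
  have "real W \<le> 2 * r / \<mu>" unfolding W by simp
  then have W_le: "real W * \<mu> \<le> 2 * r" using \<mu>(1) by (simp add: pos_le_divide_eq)
  have "2 * r / \<mu> < real W + 1" unfolding W by linarith
  then have "2 * r < real W * \<mu> + \<mu>" using \<mu>(1) by (simp add: field_simps)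
  then have W_ge: "real W * \<mu> > r" using \<open>\<mu> < r\<close> by linarith
  \<comment> \<open>The exponent \<open>card I + 3\<close> in \<open>h\<close> is chosen here:
    finding a window of length \<open>2 * W\<close> takes travel at most 1/2.\<close>
  have pow: "2 ^ card I * (4 * r) = 1 / 2"
    unfolding r_def by (simp add: power_add)
  have total: "2 ^ card I * real (2 * W) * \<mu> \<le> 1 / 2"
  proof -
    have "2 ^ card I * real (2 * W) * \<mu> = 2 ^ card I * (2 * (real W * \<mu>))" by simp
    also have "\<dots> \<le> 2 ^ card I * (4 * r)"
      by (rule mult_left_mono) (use W_le in linarith, simp)
    finally show ?thesis unfolding pow .
  qed
  have "2 ^ card I * real (2 * W) * \<bar>\<phi> i\<bar> < 1" if "i \<in> I" for i
  proof -
    have "2 ^ card I * real (2 * W) * \<bar>\<phi> i\<bar> \<le> 2 ^ card I * real (2 * W) * \<mu>"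
      using le[OF that] by (intro mult_left_mono) auto
    with total show ?thesis by linarith
  qed
  from floor_constant_window[where x = x and \<phi> = \<phi>, OF fin this] obtain b
    where b: "b + 2 * W \<le> 2 ^ card I * (2 * W)"
      and fl: "\<And>i j. i \<in> I \<Longrightarrow> j \<in> {b..b + 2 * W} \<Longrightarrow>
        \<lfloor>x i + real j * \<phi> i\<rfloor> = \<lfloor>x i + real b * \<phi> i\<rfloor>"
    by blast
  define y where "y i = frac (x i + real b * \<phi> i)" for i
  \<comment> \<open>With the floors frozen, the fractional parts are affine in
    \<open>t\<close>.\<close>
  have fr: "frac (x i + real (b + t) * \<phi> i) = y i + real t * \<phi> i"
    if "i \<in> I" "t \<le> 2 * W" for i t
    using fl[of i "b + t"] that by (simp add: frac_def y_def algebra_simps)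
  have quad: "g (b + t) = (\<Sum>i\<in>I. (y i + real t * \<phi> i)\<^sup>2)" if "t \<le> 2 * W" for t
    unfolding g_def radius_sq_def using fr that by simp
  \<comment> \<open>Each summand changes by (u + v) * (u - v), where |u + v| \<le> 2 and u - v =
    \<phi> i.\<close>
  have step: "\<bar>g (Suc j) / h - g j / h\<bar> < 1" if j: "b \<le> j" "j < b + 2 * W" for j
  proof -
    have "\<bar>g (Suc j) - g j\<bar> \<le> (\<Sum>i\<in>I. 2 * \<mu>)"
    proof -
      have "\<bar>(frac (x i + real (Suc j) * \<phi> i))\<^sup>2 - (frac (x i + real j * \<phi> i))\<^sup>2\<bar> \<le> 2 * \<mu>"
        if i: "i \<in> I" for i
      proof -
        let ?u = "frac (x i + real (Suc j) * \<phi> i)" and ?v = "frac (x i + real j * \<phi> i)"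
        have diff: "?u - ?v = \<phi> i"
          using fl[of i j] fl[of i "Suc j"] i j by (simp add: frac_def algebra_simps)
        have "\<bar>?u + ?v\<bar> \<le> 2"
          using frac_lt_1[of "x i + real (Suc j) * \<phi> i"] frac_lt_1[of "x i + real j * \<phi> i"]
            frac_ge_0[of "x i + real (Suc j) * \<phi> i"] frac_ge_0[of "x i + real j * \<phi> i"]
          by linarith
        then have "\<bar>?u + ?v\<bar> * \<bar>?u - ?v\<bar> \<le> 2 * \<mu>"
          unfolding diff using le[OF i] by (intro mult_mono) auto
        then show ?thesis
          by (simp only: power2_eq_square square_diff_square_factored abs_mult)
      qed
      then show ?thesis
        unfolding g_def radius_sq_def sum_subtractf[symmetric]
        by (intro order.trans[OF sum_abs] sum_mono)
    qed
    also have "\<dots> < h" using \<mu>(2) by simp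
    finally show ?thesis
      using h0 by (simp add: diff_divide_distrib[symmetric] abs_divide)
  qed
  have col: "even \<lfloor>g j / h\<rfloor> = col" if "b \<le> j" "j \<le> b + 2 * W" for j
  proof (rule mono)
    have "real j \<le> 2 ^ card I * real (2 * W)"
    proof -
      have "j \<le> 2 ^ card I * (2 * W)" using that b by linarith
      then have "real j \<le> real (2 ^ card I * (2 * W))" by (simp only: of_nat_le_iff)
      then show ?thesis by simp
    qed
    then show "real j * \<mu> \<le> 1"
      using total \<mu>(1) mult_right_mono[of "real j" "2 ^ card I * real (2 * W)" \<mu>] by linarith
  qed
  have shell: "\<lfloor>g (b + t) / h\<rfloor> = \<lfloor>g b / h\<rfloor>" if "t \<le> 2 * W" for t
    using same_parity_imp_floor_constant[where c = "b + 2 * W" and g = "\<lambda>j. g j / h" and col = col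
        and b = b and j = "b + t"] step col that by simp
  have near: "\<bar>g (b + t) / h - g (b + W) / h\<bar> < 1" if "t \<le> 2 * W" for t
    using shell[OF that] shell[of W] by linarith
  have near': "\<bar>g (b + t) - g (b + W)\<bar> < h" if "t \<le> 2 * W" for t
    using near[OF that] h0 by (simp add: diff_divide_distrib[symmetric] abs_divide)
  \<comment> \<open>Constant and linear terms cancel. The sum that remains is bounded below by its
    \<open>k\<close>-th term alone.\<close>
  have second: "g (b + 2 * W) - 2 * g (b + W) + g (b + 0) = (\<Sum>i\<in>I. 2 * (real W * \<phi> i)\<^sup>2)"
  proof -
    have "g (b + 2 * W) - 2 * g (b + W) + g (b + 0)
      = (\<Sum>i\<in>I. (y i + real (2 * W) * \<phi> i)\<^sup>2 - 2 * (y i + real W * \<phi> i)\<^sup>2 + (y i + real 0 * \<phi> i)\<^sup>2)"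
      using quad[of "2 * W"] quad[of W] quad[of 0]
      by (simp only: sum.distrib sum_subtractf sum_distrib_left)
    also have "\<dots> = (\<Sum>i\<in>I. 2 * (real W * \<phi> i)\<^sup>2)"
      by (intro sum.cong) (auto simp: power2_eq_square algebra_simps)
    finally show ?thesis .
  qed
  have "2 * h \<le> 2 * (real W * \<phi> k)\<^sup>2"
    using W_ge r k(2) power_mono[of r "real W * \<mu>" 2] by (auto simp: power_mult_distrib)
  also have "\<dots> \<le> (\<Sum>i\<in>I. 2 * (real W * \<phi> i)\<^sup>2)"
    using fin k(1) by (intro member_le_sum) auto
  also have "\<dots> < 2 * h"
    using second near'[of 0] near'[of "2 * W"] by simp
  finally show False by simp
qed

text \<open>Dividing by the factorial \<open>m\<close> prevents the approximation from being too
  good. As \<open>q\<close> divides \<open>m\<close>, write m = q * r; then q * s * \<alpha> i / m =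
  s * \<alpha> i / r, and an error e at the integer \<open>p i\<close> puts s * \<alpha> i within r
  * e of the integer r * p i.\<close>

lemma Dirichlet_bounded_away:
  fixes \<alpha> :: "nat \<Rightarrow> real" and d N s :: nat
  defines "m \<equiv> fact (N ^ d)"
  assumes "N > 0" and far: "\<exists>i\<in>{1..d}. dist_int (real s * \<alpha> i) > \<epsilon>"
  obtains q :: nat and p :: "nat \<Rightarrow> int" where "q \<le> N ^ d"
    and "\<And>i. i \<in> {1..d} \<Longrightarrow> \<bar>real (q * s) * (\<alpha> i / m) - p i\<bar> < 1 / N"
    and "\<exists>i\<in>{1..d}. \<bar>real (q * s) * (\<alpha> i / m) - p i\<bar> > \<epsilon> / m"
proof -
  obtain q' p' where q': "0 < q'" "q' \<le> int (N ^ d)"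
    and p': "\<And>i. i < d \<Longrightarrow> \<bar>of_int q' * (real s * (\<alpha> (Suc i) / m)) - of_int (p' i)\<bar> < 1 / N"
    using Dirichlet_approx_simult[OF \<open>N > 0\<close>, of d "\<lambda>i. real s * (\<alpha> (Suc i) / m)"] by metis
  \<comment> \<open>Dirichlet's theorem counts coordinates from 0, here they start at 1.\<close>
  define q p where "q = nat q'" and "p i = p' (i - 1)" for i
  have q: "q > 0" "q \<le> N ^ d" "of_int q' = real q"
    using q' by (auto simp: q_def nat_le_iff)
  have approx: "\<bar>real (q * s) * (\<alpha> i / m) - p i\<bar> < 1 / N" if "i \<in> {1..d}" for i
  proof -
    have "i - 1 < d" "Suc (i - 1) = i" using that by auto
    with p'[of "i - 1"] q(3) show ?thesis by (simp add: p_def mult.assoc)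
  qed
  have "q dvd fact (N ^ d)" using q by (intro dvd_fact) auto
  then obtain r where r: "fact (N ^ d) = q * r" by auto
  have m: "m = real q * real r"
    unfolding m_def by (metis r of_nat_fact of_nat_mult)
  have r0: "r > 0" using r by (metis fact_nonzero gr0I mult_0_right)
  have m0: "m > 0" by (simp add: m_def)
  from far obtain i where i: "i \<in> {1..d}" "dist_int (real s * \<alpha> i) > \<epsilon>" by blast
  let ?e = "\<bar>real (q * s) * (\<alpha> i / m) - p i\<bar>"
  have "dist_int (real s * \<alpha> i) \<le> dist (real s * \<alpha> i) (of_int (int r * p i))"
    unfolding dist_int_def by (intro infdist_le) (rule Ints_of_int)
  also have "\<dots> = real r * ?e"
  proof -
    have "real s * \<alpha> i - of_int (int r * p i) = real r * (real (q * s) * (\<alpha> i / m) - p i)"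
      using q(1) r0 unfolding m by (simp add: field_simps)
    then show ?thesis by (simp add: dist_real_def abs_mult)
  qed
  also have "\<dots> \<le> m * ?e"
    using q(1) mult_right_mono[of 1 "real q" "real r"] unfolding m by (intro mult_right_mono) auto
  finally have "?e > \<epsilon> / m" using i(2) m0 by (simp add: field_simps)
  with i(1) approx q that show thesis by blast
qed

theorem theorem1p6:
  fixes S :: "nat set" and d :: nat and \<alpha> :: "nat \<Rightarrow> real" and \<epsilon> :: real
  assumes "S \<subseteq> {0<..}"
    and "d \<ge> 1"
    and "\<epsilon> > 0"
    and "\<And>s. s \<in> S \<Longrightarrow> \<exists>i\<in>{1..d}. dist_int (real s * \<alpha> i) > \<epsilon>"
  shows "\<not> two_large S"
proof
  assume large: "two_large S"
  define I where "I = {1..d}"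
  have I: "finite I" "card I = d" by (auto simp: I_def)
  define h :: real where "h = (1 / 2 ^ (card I + 3))\<^sup>2"
  have h0: "h > 0" by (simp add: h_def)
  \<comment> \<open>Dirichlet's error 1 / N has to satisfy 2 * d / N < h, so that no single step
    skips a shell.\<close>
  obtain N :: nat where N: "N > 2 * real d / h" using reals_Archimedean2 by blast
  have N0: "N > 0"
    using N h0 by (metis divide_nonneg_pos gr0I
        less_le_not_le mult_nonneg_nonneg of_nat_0 of_nat_0_le_iff zero_le_numeral)
  \<comment> \<open>The colouring must be fixed before \<open>s\<close> and \<open>q\<close> are
    known, so \<open>m\<close> is a common multiple of all possible \<open>q\<close>.\<close>
  define m :: real where "m = fact (N ^ d)"
  have m0: "m > 0" by (simp add: m_def)
  define c where "c n = even \<lfloor>radius_sq I (\<lambda>i. real n * (\<alpha> i / m)) / h\<rfloor>" for n :: nat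
  \<comment> \<open>Larger than every index q * j that can occur: \<open>q\<close> is at most
    \<open>N ^ d\<close>, and j * \<mu> \<le> 1 with \<mu> > \<epsilon> / m forces j \<le> m /
    \<epsilon>.\<close>
  define K where "K = N ^ d * nat \<lfloor>m / \<epsilon>\<rfloor> + 1"
  have "K > 0" by (simp add: K_def)
  then obtain a s col where s: "s \<in> S" and mono: "\<And>j. j < K \<Longrightarrow> c (a + j * s) = col"
    using large[unfolded two_large_def, THEN spec[of _ c], THEN spec[of _ K]] by blast
  obtain q :: nat and p :: "nat \<Rightarrow> int" where q: "q \<le> N ^ d"
    and near: "\<And>i. i \<in> I \<Longrightarrow> \<bar>real (q * s) * (\<alpha> i / m) - p i\<bar> < 1 / N"
    and far: "\<exists>i\<in>I. \<bar>real (q * s) * (\<alpha> i / m) - p i\<bar> > \<epsilon> / m"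
    using Dirichlet_bounded_away[OF N0 assms(4)[OF s]] unfolding I_def m_def by metis
  define \<phi> where "\<phi> i = real (q * s) * (\<alpha> i / m) - p i" for i
  define \<mu> where "\<mu> = Max ((\<lambda>i. \<bar>\<phi> i\<bar>) ` I)"
  have ne: "I \<noteq> {}" using assms(2) by (auto simp: I_def)
  have le: "\<bar>\<phi> i\<bar> \<le> \<mu>" if "i \<in> I" for i
    unfolding \<mu>_def using that I by simp
  have "\<mu> \<in> (\<lambda>i. \<bar>\<phi> i\<bar>) ` I"
    unfolding \<mu>_def using I ne by (intro Max_in) auto
  then obtain k where k: "k \<in> I" "\<bar>\<phi> k\<bar> = \<mu>" by auto
  have \<mu>_far: "\<mu> > \<epsilon> / m"
    using far le unfolding \<phi>_def by (meson less_le_trans)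
  then have \<mu>0: "\<mu> > 0" using assms(3) m0 by (smt (verit) divide_pos_pos)
  have "\<mu> < 1 / N" using near[OF k(1)] k(2) by (simp add: \<phi>_def)
  then have "2 * real (card I) * \<mu> < 2 * real d * (1 / N)"
    unfolding I(2) using assms(2) by (intro mult_strict_left_mono) auto
  also have "\<dots> < h" using N N0 h0 by (simp add: field_simps)
  finally have small: "2 * real (card I) * \<mu> < h" .
  obtain j where j: "real j * \<mu> \<le> 1"
    and ncol: "even \<lfloor>radius_sq I (\<lambda>i. real a * (\<alpha> i / m) + real j * \<phi> i) / h\<rfloor> \<noteq> col"
    using shells_not_monochromatic[where \<phi> = \<phi> and x = "\<lambda>i. real a * (\<alpha> i / m)" and col = col,
        OF I(1) h_def \<mu>0 small le k] by auto
  \<comment> \<open>Every \<open>q\<close>-th term of the progression moves the point by \<phi>, up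
    to the integers \<open>p i\<close>, which \<open>frac\<close> discards.\<close>
  have "frac (real (a + q * j * s) * (\<alpha> i / m)) = frac (real a * (\<alpha> i / m) + real j * \<phi> i)" for i
  proof -
    have "real (a + q * j * s) * (\<alpha> i / m)
      = (real a * (\<alpha> i / m) + real j * \<phi> i) + of_int (int j * p i)"
      by (simp add: \<phi>_def algebra_simps)
    then show ?thesis by (simp add: frac_def)
  qed
  then have "c (a + q * j * s) \<noteq> col"
    using ncol by (simp add: c_def radius_sq_def)
  moreover have "q * j < K"
  proof -
    have "real j * (\<epsilon> / m) \<le> 1"
      using j mult_left_mono[of "\<epsilon> / m" \<mu> "real j"] \<mu>_far by linarith
    then have "real j \<le> m / \<epsilon>" using assms(3) m0 by (simp add: field_simps)
    then have "j \<le> nat \<lfloor>m / \<epsilon>\<rfloor>" by (simp add: le_nat_floor)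
    then show ?thesis using q by (simp add: K_def less_Suc_eq_le mult_le_mono)
  qed
  ultimately show False using mono by blast
qed

end
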